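(* Consider $P(\omega)$ with the Michael topology. If $\mathfrak{b}=\aleph_1$, then there is a subspace $X\subseteq P(\omega)$ which is a $\gamma$-space and is also a Michael space, i.e., $X$ is Lindelöf and $X\times\mathbb{P}$ is not Lindelöf, where $\mathbb{P}$ is the space of irrational numbers.
   Context: $P(\omega)$ is identified with the Cantor space $2^\omega$ via characteristic functions, giving the Cantor topology. The Michael topology on $P(\omega)$ is the finer topology obtained by additionally declaring every infinite subset of $\omega$ to be an isolated point. For $f,g\in\omega^\omega$, $f\le^* g$ means $f(n)\le g(n)$ for all but finitely many $n$; $\mathfrak{b}$ is the minimal cardinality of a subset of $\omega^\omega$ that is unbounded with respect to $\le^*$. An open cover $\mathcal{U}$ of a space $X$ is an $\omega$-cover if $X\notin\mathcal{U}$ and every finite subset of $X$ is included in some member of $\mathcal{U}$. A point-cofinite cover is an infinite open cover such that each point belongs to all but finitely many of its members. $X$ is a $\gamma$-space if every $\omega$-cover of $X$ includes a point-cofinite cover. *)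

theory Defs
  imports "HOL-Analysis.Analysis"
begin

definition le_star :: "(nat \<Rightarrow> nat) \<Rightarrow> (nat \<Rightarrow> nat) \<Rightarrow> bool" where
  "le_star f g \<longleftrightarrow> finite {n. \<not> f n \<le> g n}"

definition unbounded_family :: "(nat \<Rightarrow> nat) set \<Rightarrow> bool" where
  "unbounded_family F \<longleftrightarrow> \<not> (\<exists>g. \<forall>f\<in>F. le_star f g)"

abbreviation aleph1 :: "nat set rel" where
  "aleph1 \<equiv> cardSuc natLeq"

definition b_eq_aleph1 :: bool where
  "b_eq_aleph1 \<longleftrightarrow>
     (\<exists>F. unbounded_family F \<and> (card_of F, aleph1) \<in> ordIso) \<and>
     (\<forall>F. unbounded_family F \<longrightarrow> (aleph1, card_of F) \<in> ordLeq)"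

definition cantor_topology :: "nat set topology" where
  "cantor_topology = topology (\<lambda>U. \<exists>V. openin (product_topology (\<lambda>_. discrete_topology (UNIV::bool set)) UNIV) V
                                      \<and> U = (\<lambda>A n. n \<in> A) -` V)"

definition michael_topology :: "nat set topology" where
  "michael_topology = topology_generated_by ({U. openin cantor_topology U} \<union> {{A} | A. infinite A})"

definition irrationals_topology :: "real topology" where
  "irrationals_topology = subtopology euclideanreal (- \<rat>)"

definition omega_cover :: "'a topology \<Rightarrow> 'a set set \<Rightarrow> bool" where
  "omega_cover T \<U> \<longleftrightarrow> (\<forall>U\<in>\<U>. openin T U) \<and> \<Union>\<U> = topspace T \<and> topspace T \<notin> \<U> \<and>
     (\<forall>F. finite F \<and> F \<subseteq> topspace T \<longrightarrow> (\<exists>U\<in>\<U>. F \<subseteq> U))"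

definition point_cofinite_cover :: "'a topology \<Rightarrow> 'a set set \<Rightarrow> bool" where
  "point_cofinite_cover T \<V> \<longleftrightarrow> infinite \<V> \<and> (\<forall>V\<in>\<V>. openin T V) \<and> \<Union>\<V> = topspace T \<and>
     (\<forall>x\<in>topspace T. finite {V\<in>\<V>. x \<notin> V})"

definition gamma_space :: "'a topology \<Rightarrow> bool" where
  "gamma_space T \<longleftrightarrow> (\<forall>\<U>. omega_cover T \<U> \<longrightarrow> (\<exists>\<V>\<subseteq>\<U>. point_cofinite_cover T \<V>))"

end

theory Submission
  imports Defs
begin

text \<open>The space is \<open>X = Fin \<union> {x\<^sub>i | i < \<omega>\<^sub>1}\<close>, where the \<open>x\<^sub>i\<close> are infinite, decrease modulo finite
  sets, and are unbounded: for every partition of \<open>\<omega>\<close> into finite intervals some \<open>x\<^sub>i\<close> misses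
  infinitely many of them. Such a tower is built by recursion along an unbounded family
  \<open>{f\<^sub>i | i < \<omega>\<^sub>1}\<close>, choosing \<open>x\<^sub>i\<close> as a pseudo-intersection of its countably many predecessors whose
  gaps exceed \<open>f\<^sub>i\<close>.

  Given an \<open>\<omega>\<close>-cover and \<open>i < \<omega>\<^sub>1\<close>, the Galvin--Miller argument yields an interval partition and members
  \<open>U k\<close> of the cover such that \<open>U k\<close> contains every point of \<open>X\<close> missing the \<open>k\<close>-th interval, while each
  \<open>x\<^sub>j\<close> with \<open>j < i\<close> lies in almost all \<open>U k\<close>. Iterating along \<open>\<alpha>\<^sub>0 < \<alpha>\<^sub>1 < \<dots>\<close> with supremum \<open>l\<close>, so that \<open>x\<^sub>l\<close>
  misses infinitely many intervals of each of the partitions, one picks diagonally one member from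
  each sequence. The \<open>x\<^sub>j\<close> with \<open>j < l\<close> are countably many and are captured by domination; all other
  points of \<open>X\<close> are almost contained in \<open>x\<^sub>l\<close> and hence miss almost all of the chosen intervals.

  The map \<open>\<phi>(A) = \<Sum>n\<in>A. 1/(n+2)!\<close> is continuous, rational at finite sets and irrational at infinite
  ones. So the graph of \<open>\<phi>\<close> over the uncountably many isolated points of \<open>X\<close> is closed and discrete in
  the product of \<open>X\<close> with the irrationals, which is therefore not Lindelof.\<close>

section \<open>The Michael topology\<close>

lemma agree_below_mono:
  fixes m n :: nat
  assumes "B \<inter> {..<n} = A \<inter> {..<n}" "m \<le> n"
  shows "B \<inter> {..<m} = A \<inter> {..<m}"
proof -
  have "{..<m} = {..<n} \<inter> {..<m}" using assms(2) by auto
  then show ?thesis using assms(1) by (metis Int_assoc)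
qed

text \<open>A basic open set of the product restricts only finitely many coordinates, all below some
  \<open>n\<close>, so it contains the cylinder of sets agreeing with a given member below
  \<open>n\<close>. Conversely a cylinder is itself a product of this kind.\<close>

lemma openin_cantor_topology:
  "openin cantor_topology U \<longleftrightarrow>
     (\<forall>A\<in>U. \<exists>n. \<forall>B. B \<inter> {..<n} = A \<inter> {..<n} \<longrightarrow> B \<in> U)" (is "_ \<longleftrightarrow> ?R U")
proof -
  let ?\<chi> = "\<lambda>(A::nat set) n. n \<in> A"
  let ?P = "product_topology (\<lambda>_::nat. discrete_topology (UNIV::bool set)) UNIV"
  have surj: "f = ?\<chi> (Collect f)" for f :: "nat \<Rightarrow> bool" by simp
  have eq: "(\<exists>V. openin ?P V \<and> U = ?\<chi> -` V) \<longleftrightarrow> ?R U" for U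
  proof
    assume "\<exists>V. openin ?P V \<and> U = ?\<chi> -` V"
    then obtain V where V: "openin ?P V" and U: "U = ?\<chi> -` V" by blast
    show "?R U"
    proof
      fix A assume "A \<in> U"
      then have "?\<chi> A \<in> V" using U by blast
      then obtain W where W: "finite {i. W i \<noteq> (UNIV::bool set)}" "?\<chi> A \<in> Pi\<^sub>E UNIV W" "Pi\<^sub>E UNIV W \<subseteq> V"
        using V unfolding openin_product_topology_alt by auto
      obtain n where n: "\<And>i. W i \<noteq> UNIV \<Longrightarrow> i < n"
        using W(1) unfolding finite_nat_set_iff_bounded by blast
      have "B \<in> U" if B: "B \<inter> {..<n} = A \<inter> {..<n}" for B
      proof -
        have "(i \<in> B) \<in> W i" for i
        proof (cases "i < n")
          case True
          then have "(i \<in> B) = (i \<in> A)" using B by blast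
          then show ?thesis using W(2) by (auto simp: PiE_iff)
        next
          case False
          then have "W i = UNIV" using n by blast
          then show ?thesis by simp
        qed
        then show ?thesis using W(3) U by (auto simp: PiE_iff)
      qed
      then show "\<exists>n. \<forall>B. B \<inter> {..<n} = A \<inter> {..<n} \<longrightarrow> B \<in> U" by blast
    qed
  next
    assume R: "?R U"
    have "openin ?P (?\<chi> ` U)"
      unfolding openin_product_topology_alt
    proof
      fix f assume "f \<in> ?\<chi> ` U"
      then obtain A where A: "A \<in> U" "f = ?\<chi> A" by blast
      then obtain n where n: "\<And>B. B \<inter> {..<n} = A \<inter> {..<n} \<Longrightarrow> B \<in> U" using R by blast
      let ?W = "\<lambda>i. if i < n then {i \<in> A} else UNIV"
      have "finite {i. ?W i \<noteq> UNIV}"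
        by (rule finite_subset[of _ "{..<n}"]) auto
      moreover have "Pi\<^sub>E UNIV ?W \<subseteq> ?\<chi> ` U"
      proof
        fix g assume "g \<in> Pi\<^sub>E UNIV ?W"
        then have g: "g i \<in> ?W i" for i by (auto simp: PiE_iff)
        have "g i = (i \<in> A)" if "i < n" for i using g[of i] that by simp
        then have "Collect g \<inter> {..<n} = A \<inter> {..<n}" by auto
        then show "g \<in> ?\<chi> ` U" using n surj by (metis imageI)
      qed
      ultimately show "\<exists>W. finite {i \<in> UNIV. W i \<noteq> topspace (discrete_topology (UNIV::bool set))} \<and>
            (\<forall>i\<in>UNIV. openin (discrete_topology UNIV) (W i)) \<and> f \<in> Pi\<^sub>E UNIV W \<and> Pi\<^sub>E UNIV W \<subseteq> ?\<chi> ` U"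
        using A by (intro exI[of _ ?W]) (auto simp: PiE_iff)
    qed
    moreover have "inj ?\<chi>" by (rule injI) (metis Collect_mem_eq)
    then have "U = ?\<chi> -` (?\<chi> ` U)" by (simp add: inj_vimage_image_eq)
    ultimately show "\<exists>V. openin ?P V \<and> U = ?\<chi> -` V" by blast
  qed
  \<comment> \<open>\<open>openin\<close> recovers a predicate from \<open>topology\<close> only if
    the predicate is closed under binary intersections and arbitrary unions.\<close>
  have "istopology ?R"
    unfolding istopology_def
  proof (intro conjI allI impI ballI)
    fix S T A assume ST: "?R S" "?R T" and A: "A \<in> S \<inter> T"
    obtain n where n: "\<And>B. B \<inter> {..<n} = A \<inter> {..<n} \<Longrightarrow> B \<in> S" using A ST(1) by blast
    obtain m where m: "\<And>B. B \<inter> {..<m} = A \<inter> {..<m} \<Longrightarrow> B \<in> T" using A ST(2) by blast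
    have "B \<in> S \<inter> T" if "B \<inter> {..<max n m} = A \<inter> {..<max n m}" for B
    proof -
      show ?thesis using n[OF agree_below_mono[OF that]] m[OF agree_below_mono[OF that]] by simp
    qed
    then show "\<exists>n. \<forall>B. B \<inter> {..<n} = A \<inter> {..<n} \<longrightarrow> B \<in> S \<inter> T" by blast
  next
    fix \<K> A assume K: "\<forall>K\<in>\<K>. ?R K" and "A \<in> \<Union> \<K>"
    then obtain K where "K \<in> \<K>" "A \<in> K" by blast
    then show "\<exists>n. \<forall>B. B \<inter> {..<n} = A \<inter> {..<n} \<longrightarrow> B \<in> \<Union> \<K>"
      using K by (meson UnionI)
  qed
  then have "openin (topology ?R) = ?R" by (rule topology_inverse')
  then show ?thesis
    unfolding cantor_topology_def eq by (rule fun_cong)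
qed

text \<open>Isolated points impose no condition, so only the finite members of an open set need a
  cylinder around them.\<close>

lemma openin_michael_topology:
  "openin michael_topology U \<longleftrightarrow>
     (\<forall>A\<in>U. finite A \<longrightarrow> (\<exists>n. \<forall>B. B \<inter> {..<n} = A \<inter> {..<n} \<longrightarrow> B \<in> U))" (is "_ \<longleftrightarrow> ?R U")
proof
  let ?S = "{U. openin cantor_topology U} \<union> {{A} | A. infinite A}"
  show "?R U" if "openin michael_topology U"
  proof -
    have "generate_topology_on ?S U"
      using that unfolding michael_topology_def openin_topology_generated_by_iff .
    then show ?thesis
    proof (induction rule: generate_topology_on.induct)
      case Empty
      show ?case by simp
    next
      case (Int S T)
      show ?case
      proof (intro ballI impI)
        fix A assume A: "A \<in> S \<inter> T" "finite A"
        obtain n where n: "\<And>B. B \<inter> {..<n} = A \<inter> {..<n} \<Longrightarrow> B \<in> S" using A Int.IH(1) by blast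
        obtain m where m: "\<And>B. B \<inter> {..<m} = A \<inter> {..<m} \<Longrightarrow> B \<in> T" using A Int.IH(2) by blast
        have "B \<in> S \<inter> T" if B: "B \<inter> {..<max n m} = A \<inter> {..<max n m}" for B
        proof -
          show ?thesis using n[OF agree_below_mono[OF B]] m[OF agree_below_mono[OF B]] by simp
        qed
        then show "\<exists>n. \<forall>B. B \<inter> {..<n} = A \<inter> {..<n} \<longrightarrow> B \<in> S \<inter> T" by blast
      qed
    next
      case (UN K)
      then show ?case by (meson UnionE UnionI)
    next
      case (Basis s)
      then show ?case unfolding openin_cantor_topology by auto
    qed
  qed
  show "openin michael_topology U" if R: "?R U"
  proof (subst openin_subopen, intro ballI)
    fix A assume A: "A \<in> U"
    have basis: "openin michael_topology S" if "S \<in> ?S" for S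
      using that unfolding michael_topology_def by (rule topology_generated_by_Basis)
    show "\<exists>T. openin michael_topology T \<and> A \<in> T \<and> T \<subseteq> U"
    proof (cases "finite A")
      case True
      then obtain n where n: "\<And>B. B \<inter> {..<n} = A \<inter> {..<n} \<Longrightarrow> B \<in> U" using A R by blast
      let ?T = "{B. B \<inter> {..<n} = A \<inter> {..<n}}"
      have "openin cantor_topology ?T" unfolding openin_cantor_topology by auto
      then have "openin michael_topology ?T" by (intro basis) simp
      then show ?thesis using n by (intro exI[of _ ?T]) auto
    next
      case False
      then have "openin michael_topology {A}" by (intro basis) auto
      then show ?thesis using A by blast
    qed
  qed
qed

lemma topspace_michael_topology [simp]: "topspace michael_topology = UNIV"
  using openin_subset[of michael_topology UNIV] by (auto simp: openin_michael_topology)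

text \<open>The finite unions from an open cover form an \<omega>-cover, unless one of them is
  already the whole space. Any countably infinite part of a point-cofinite cover still covers, since
  a point is missed by only finitely many members; splitting these unions up again leaves countably
  many sets.\<close>

lemma gamma_space_imp_Lindelof_space:
  assumes "gamma_space T"
  shows "Lindelof_space T"
  unfolding Lindelof_space_def
proof (intro allI impI, elim conjE)
  fix \<O> assume op: "\<forall>U\<in>\<O>. openin T U" and cov: "\<Union>\<O> = topspace T"
  define \<U> where "\<U> = {\<Union>\<F> |\<F>. finite \<F> \<and> \<F> \<subseteq> \<O>}"
  show "\<exists>\<V>. countable \<V> \<and> \<V> \<subseteq> \<O> \<and> \<Union>\<V> = topspace T"
  proof (cases "topspace T \<in> \<U>")
    case True
    then show ?thesis unfolding \<U>_def by (auto intro: countable_finite)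
  next
    case False
    have "omega_cover T \<U>"
      unfolding omega_cover_def
    proof (intro conjI allI impI ballI)
      show "openin T U" if "U \<in> \<U>" for U using that op unfolding \<U>_def by blast
      have "U \<in> \<U>" if "U \<in> \<O>" for U
        unfolding \<U>_def using that by (intro CollectI exI[of _ "{U}"]) auto
      then have "\<Union>\<O> \<subseteq> \<Union>\<U>" by (intro Union_mono subsetI)
      moreover have "\<Union>\<U> \<subseteq> \<Union>\<O>" unfolding \<U>_def by blast
      ultimately show "\<Union>\<U> = topspace T" using cov by simp
      show "topspace T \<notin> \<U>" by fact
      fix F assume F: "finite F \<and> F \<subseteq> topspace T"
      then have "F \<subseteq> \<Union>\<O>" using cov by simp
      with F obtain \<F> where "finite \<F>" "\<F> \<subseteq> \<O>" "F \<subseteq> \<Union>\<F>"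
        using finite_subset_Union[of F \<O>] by blast
      then show "\<exists>U\<in>\<U>. F \<subseteq> U" unfolding \<U>_def by blast
    qed
    then obtain \<V> where \<V>: "\<V> \<subseteq> \<U>" "point_cofinite_cover T \<V>"
      using assms unfolding gamma_space_def by blast
    then obtain \<W> where \<W>: "\<W> \<subseteq> \<V>" "infinite \<W>" "countable \<W>"
      using infinite_countable_subset' unfolding point_cofinite_cover_def by metis
    have "\<forall>W\<in>\<W>. \<exists>\<F>. finite \<F> \<and> \<F> \<subseteq> \<O> \<and> W = \<Union>\<F>"
    proof
      fix W assume "W \<in> \<W>"
      then have "W \<in> \<U>" using \<W>(1) \<V>(1) by blast
      then show "\<exists>\<F>. finite \<F> \<and> \<F> \<subseteq> \<O> \<and> W = \<Union>\<F>" unfolding \<U>_def by simp metis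
    qed
    from bchoice[OF this] obtain \<F>
      where \<F>: "\<forall>W\<in>\<W>. finite (\<F> W) \<and> \<F> W \<subseteq> \<O> \<and> W = \<Union>(\<F> W)" ..
    have "topspace T \<subseteq> \<Union>\<W>"
    proof
      fix x assume "x \<in> topspace T"
      then have "finite {V\<in>\<V>. x \<notin> V}" using \<V>(2) unfolding point_cofinite_cover_def by blast
      then have "\<not> \<W> \<subseteq> {V\<in>\<V>. x \<notin> V}" using \<W>(2) finite_subset by blast
      then show "x \<in> \<Union>\<W>" using \<W>(1) by blast
    qed
    moreover have "\<Union>\<W> \<subseteq> \<Union>(\<Union>(\<F> ` \<W>))"
    proof
      fix x assume "x \<in> \<Union>\<W>"
      then obtain W where W: "W \<in> \<W>" "x \<in> W" by blast
      then have "x \<in> \<Union>(\<F> W)" using \<F> by simp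
      with W(1) show "x \<in> \<Union>(\<Union>(\<F> ` \<W>))" by blast
    qed
    moreover have "\<Union>(\<F> ` \<W>) \<subseteq> \<O>" using \<F> by blast
    moreover have "countable (\<Union>(\<F> ` \<W>))" using \<W>(3) \<F> by (auto intro: countable_finite)
    ultimately show ?thesis using cov by (intro exI[of _ "\<Union>(\<F> ` \<W>)"]) blast
  qed
qed

section \<open>Unbounded towers\<close>

text \<open>The bound over all \<open>l \<le> m\<close> stands for the running maximum of
  \<open>f\<close>, as \<open>f\<close> is an arbitrary function.\<close>

definition sparse_for :: "(nat \<Rightarrow> nat) \<Rightarrow> nat set \<Rightarrow> bool" where
  "sparse_for f A \<longleftrightarrow> (\<forall>m\<in>A. \<forall>n\<in>A. m < n \<longrightarrow> (\<forall>l\<le>m. f l \<le> n))"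

definition misses :: "(nat \<Rightarrow> nat) \<Rightarrow> nat set \<Rightarrow> nat set" where
  "misses a A = {k. A \<inter> {a k..<a (Suc k)} = {}}"

text \<open>Used to see that finite intersections from a chain of infinite sets modulo finite are
  infinite: they contain almost all of an almost least member.\<close>

lemma finite_chain_has_almost_least:
  assumes "finite \<C>" "\<C> \<noteq> {}"
    and "\<And>A B. A \<in> \<C> \<Longrightarrow> B \<in> \<C> \<Longrightarrow> finite (A - B) \<or> finite (B - A)"
  shows "\<exists>M\<in>\<C>. \<forall>C\<in>\<C>. finite (M - C)"
  using assms
proof (induction rule: finite_ne_induct)
  case (singleton A)
  then show ?case by simp
next
  case (insert A \<C>)
  then obtain M where M: "M \<in> \<C>" "\<And>C. C \<in> \<C> \<Longrightarrow> finite (M - C)" by (metis insertCI)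
  show ?case
  proof (cases "finite (M - A)")
    case True
    then show ?thesis using M by blast
  next
    case False
    then have "finite (A - M)" using insert.prems M by blast
    then have "finite (A - C)" if "C \<in> \<C>" for C
      using M(2)[OF that] by (rule_tac finite_subset[of _ "(A - M) \<union> (M - C)"]) auto
    then show ?thesis by simp
  qed
qed

text \<open>Diagonalization: the \<open>n\<close>-th point is taken from the intersection of the
  first \<open>n + 1\<close> sets, so all but finitely many points lie in each set. As these
  intersections are infinite, each point can also be taken beyond the values of \<open>f\<close> up
  to its predecessor.\<close>

lemma sparse_pseudo_intersection:
  assumes "countable \<C>" and inf: "\<And>A. A \<in> \<C> \<Longrightarrow> infinite A"
    and chain: "\<And>A B. A \<in> \<C> \<Longrightarrow> B \<in> \<C> \<Longrightarrow> finite (A - B) \<or> finite (B - A)"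
  shows "\<exists>A. infinite A \<and> (\<forall>C\<in>\<C>. finite (A - C)) \<and> sparse_for f A"
proof -
  \<comment> \<open>Adding \<open>UNIV\<close> provides an enumeration even for empty
    \<open>\<C>\<close>, and it is comparable with every set.\<close>
  define c where "c = from_nat_into (insert UNIV \<C>)"
  have ran: "range c = insert UNIV \<C>"
    unfolding c_def using assms(1) by (intro range_from_nat_into) auto
  define D where "D n = (\<Inter>m\<le>n. c m)" for n
  have inf': "infinite (D n)" for n
  proof -
    have sub: "c ` {..n} \<subseteq> insert UNIV \<C>" using ran by blast
    have "finite (A - B) \<or> finite (B - A)" if "A \<in> c ` {..n}" "B \<in> c ` {..n}" for A B
      using chain[of A B] subsetD[OF sub that(1)] subsetD[OF sub that(2)] by auto
    then obtain M where M: "M \<in> c ` {..n}" "\<And>C. C \<in> c ` {..n} \<Longrightarrow> finite (M - C)"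
      using finite_chain_has_almost_least[of "c ` {..n}"] by auto
    have "finite (\<Union>C \<in> c ` {..n}. M - C)" using M(2) by blast
    moreover have "M \<subseteq> D n \<union> (\<Union>C \<in> c ` {..n}. M - C)" unfolding D_def by blast
    moreover have "infinite M" using M(1) sub inf by auto
    ultimately show ?thesis using finite_subset by blast
  qed
  have "\<exists>y. \<forall>n. y n \<in> D n \<and> (y n < y (Suc n) \<and> (\<forall>l\<le>y n. f l \<le> y (Suc n)))"
  proof (rule dependent_nat_choice)
    show "\<exists>x. x \<in> D 0" using inf'[of 0] by (metis finite.emptyI ex_in_conv)
    fix x n
    have "finite (f ` {..x})" by simp
    then obtain b where b: "\<And>l. l \<le> x \<Longrightarrow> f l \<le> b" by (metis atMost_iff finite_nat_set_iff_bounded_le imageI)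
    obtain y where "y \<in> D (Suc n)" "max x b < y" using inf'[of "Suc n"] by (meson infinite_nat_iff_unbounded)
    then show "\<exists>y. y \<in> D (Suc n) \<and> (x < y \<and> (\<forall>l\<le>x. f l \<le> y))"
      using b by (intro exI[of _ y]) (auto intro: le_trans less_imp_le)
  qed
  then obtain y where y: "\<And>n. y n \<in> D n" "\<And>n. y n < y (Suc n)" "\<And>n l. l \<le> y n \<Longrightarrow> f l \<le> y (Suc n)"
    by blast
  have mono: "strict_mono y" using y(2) by (rule strict_monoI_Suc)
  have "finite (range y - C)" if C: "C \<in> \<C>" for C
  proof -
    obtain m where m: "C = c m" using ran C by blast
    have "y n \<in> C" if "m \<le> n" for n using y(1)[of n] that unfolding D_def m by blast
    then have "range y - C \<subseteq> y ` {..<m}" using not_le by blast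
    then show ?thesis using finite_subset by blast
  qed
  moreover have "sparse_for f (range y)"
    unfolding sparse_for_def
  proof (safe, simp)
    fix p q l assume "y p < y q" and l: "l \<le> y p"
    then have "Suc p \<le> q" using mono by (simp add: strict_mono_less Suc_le_eq)
    then have "y (Suc p) \<le> y q" using mono by (simp add: strict_mono_less_eq)
    then show "f l \<le> y q" using y(3)[OF l] by simp
  qed
  moreover have "infinite (range y)"
    using mono by (simp add: finite_image_iff strict_mono_imp_inj_on)
  ultimately show ?thesis by blast
qed

text \<open>If \<open>A\<close> met almost all intervals, its elements could not grow faster than
  the partition, and sparseness would bound \<open>f\<close> by \<open>a (n + 3)\<close> for almost
  all \<open>n\<close>.\<close>

lemma sparse_misses:
  assumes sp: "sparse_for f A" and a: "strict_mono a"
    and big: "\<not> le_star f (\<lambda>n. a (n + 3))"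
  shows "infinite (misses a A)"
proof
  assume "finite (misses a A)"
  then obtain K where "\<And>k. k \<in> misses a A \<Longrightarrow> k < K"
    unfolding finite_nat_set_iff_bounded by blast
  then have hit: "\<exists>m\<in>A. a k \<le> m \<and> m < a (Suc k)" if "K \<le> k" for k
    using that unfolding misses_def by (force simp: not_le[symmetric])
  have "n < a K" if n: "\<not> f n \<le> a (n + 3)" for n
  proof (rule ccontr)
    assume nK: "\<not> n < a K"
    have id: "k \<le> a k" for k using a by (rule strict_mono_imp_increasing)
    \<comment> \<open>The index of the interval containing \<open>n\<close>.\<close>
    define k where "k = Max {k. a k \<le> n}"
    have fin: "finite {k. a k \<le> n}"
      by (rule finite_subset[of _ "{..n}"]) (use id in \<open>auto intro: le_trans[OF id]\<close>)
    have "k \<in> {k. a k \<le> n}" unfolding k_def using fin nK by (intro Max_in) (auto simp: not_less)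
    then have kn: "a k \<le> n" by simp
    have Kk: "K \<le> k" unfolding k_def using fin nK by (intro Max_ge) auto
    have "\<not> a (Suc k) \<le> n"
    proof
      assume "a (Suc k) \<le> n"
      then have "Suc k \<le> Max {k. a k \<le> n}" using fin by (intro Max_ge) auto
      then show False unfolding k_def by simp
    qed
    \<comment> \<open>Two further intervals are used: \<open>p\<close> lies above \<open>n\<close>,
      so sparseness at \<open>p\<close> and \<open>q\<close> applies to \<open>f n\<close>, and
      \<open>q\<close> stays below \<open>a (k + 3)\<close>.\<close>
    moreover obtain p where p: "p \<in> A" "a (Suc k) \<le> p" "p < a (Suc (Suc k))"
      using hit[of "Suc k"] Kk by auto
    moreover obtain q where q: "q \<in> A" "a (Suc (Suc k)) \<le> q" "q < a (Suc (Suc (Suc k)))"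
      using hit[of "Suc (Suc k)"] Kk by auto
    ultimately have "f n \<le> q" using sp unfolding sparse_for_def by auto
    moreover have "k \<le> n" using id kn le_trans by blast
    then have "a (k + 3) \<le> a (n + 3)" using a by (simp add: strict_mono_less_eq)
    ultimately show False using q(3) n by (simp add: eval_nat_numeral)
  qed
  then have "finite {n. \<not> f n \<le> a (n + 3)}" unfolding finite_nat_set_iff_bounded by blast
  then show False using big unfolding le_star_def by simp
qed

text \<open>The order axioms say that \<open>I\<close> has order type
  \<open>\<omega>\<^sub>1\<close>: a well-order with countable initial segments in which every
  countable subset is strictly bounded. Unboundedness is phrased through interval partitions, the
  form in which the covering argument consumes it.\<close>

locale unbounded_tower =
  fixes I :: "'i set" and less :: "'i \<Rightarrow> 'i \<Rightarrow> bool" (infix \<open>\<sqsubset>\<close> 50) and x :: "'i \<Rightarrow> nat set"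
  assumes wf: "wf {(i, j). i \<sqsubset> j}"
    and trans: "i \<sqsubset> j \<Longrightarrow> j \<sqsubset> k \<Longrightarrow> i \<sqsubset> k"
    and total: "i \<in> I \<Longrightarrow> j \<in> I \<Longrightarrow> i \<sqsubset> j \<or> i = j \<or> j \<sqsubset> i"
    and countable_below: "j \<in> I \<Longrightarrow> countable {i \<in> I. i \<sqsubset> j}"
    and countable_bounded: "countable C \<Longrightarrow> C \<subseteq> I \<Longrightarrow> \<exists>j\<in>I. \<forall>i\<in>C. i \<sqsubset> j"
    and infinite_x: "i \<in> I \<Longrightarrow> infinite (x i)"
    and almost_decreasing: "i \<in> I \<Longrightarrow> j \<in> I \<Longrightarrow> i \<sqsubset> j \<Longrightarrow> finite (x j - x i)"
    and unbounded: "strict_mono a \<Longrightarrow> \<exists>i\<in>I. infinite (misses a (x i))"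

section \<open>The first uncountable cardinal and the recursion along it\<close>

lemma countable_iff_ordLess_aleph1: "countable A \<longleftrightarrow> (card_of A, aleph1) \<in> ordLess"
proof -
  have "countable A \<longleftrightarrow> (card_of A, card_of (UNIV :: nat set)) \<in> ordLeq"
    unfolding countable_def card_of_ordLeq[symmetric] by simp
  also have "\<dots> \<longleftrightarrow> (card_of A, natLeq) \<in> ordLeq"
    using card_of_nat ordIso_symmetric ordLeq_ordIso_trans by blast
  also have "\<dots> \<longleftrightarrow> (card_of A, aleph1) \<in> ordLess"
    using cardSuc_ordLeq_ordLess[OF natLeq_Card_order card_of_Card_order, of A] by blast
  finally show ?thesis .
qed

lemma Card_order_aleph1: "Card_order aleph1"
  by (rule cardSuc_Card_order[OF natLeq_Card_order])

lemma countable_underS_aleph1: "i \<in> Field aleph1 \<Longrightarrow> countable (underS aleph1 i)"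
  unfolding countable_iff_ordLess_aleph1 by (rule card_of_underS[OF Card_order_aleph1])

lemma uncountable_Field_aleph1: "uncountable (Field aleph1)"
  unfolding countable_iff_ordLess_aleph1
  using card_of_Field_ordIso[OF Card_order_aleph1] not_ordLess_ordIso by blast

lemma unbounded_tower_exists:
  assumes "b_eq_aleph1"
  shows "\<exists>(I :: nat set set) less x. unbounded_tower I less x"
proof -
  define I where "I = Field aleph1"
  define less where "less i j \<longleftrightarrow> i \<in> underS aleph1 j" for i j
  have wo: "well_order_on I aleph1"
    using Card_order_aleph1 unfolding I_def card_order_on_def by blast
  have wf: "wf {(i, j). less i j}"
    using wo unfolding well_order_on_def less_def underS_def
    by (elim conjE) (rule wf_subset, auto)
  have trans: "less i j \<Longrightarrow> less j k \<Longrightarrow> less i k" for i j k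
    using wo unfolding less_def underS_def order_on_defs
    by (auto dest: transD antisymD)
  have total: "less i j \<or> i = j \<or> less j i" if "i \<in> I" "j \<in> I" for i j
    using wo that unfolding less_def underS_def order_on_defs total_on_def by auto
  have below: "countable {i \<in> I. less i j}" if "j \<in> I" for j
    by (rule countable_subset[OF _ countable_underS_aleph1[OF that[unfolded I_def]]])
      (auto simp: less_def)
  \<comment> \<open>If \<open>C\<close> had no strict bound, the countable initial segments up to
    its members would cover the uncountable set \<open>I\<close>.\<close>
  have bounded: "\<exists>j\<in>I. \<forall>i\<in>C. less i j" if C: "countable C" "C \<subseteq> I" for C
  proof (rule ccontr)
    assume no_bound: "\<not> (\<exists>j\<in>I. \<forall>i\<in>C. less i j)"
    have "I \<subseteq> (\<Union>i\<in>C. insert i {j \<in> I. less j i})"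
    proof
      fix j assume j: "j \<in> I"
      then obtain i where "i \<in> C" "\<not> less i j" using no_bound by blast
      then show "j \<in> (\<Union>i\<in>C. insert i {j \<in> I. less j i})" using total[OF j, of i] j C(2) by auto
    qed
    moreover have "countable (\<Union>i\<in>C. insert i {j \<in> I. less j i})" using C below by auto
    ultimately show False using uncountable_Field_aleph1 countable_subset unfolding I_def by blast
  qed
  obtain F where F: "unbounded_family F" "(card_of F, aleph1) \<in> ordIso"
    using assms unfolding b_eq_aleph1_def by blast
  have "(card_of I, card_of F) \<in> ordIso"
    using F(2) card_of_Field_ordIso[OF Card_order_aleph1] ordIso_symmetric ordIso_transitive
    unfolding I_def by blast
  then obtain f where f: "bij_betw f I F" unfolding card_of_ordIso[symmetric] by blast
  \<comment> \<open>The recursion runs over the whole type, so the requirement is guarded by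
    \<open>i \<in> I\<close>.\<close>
  let ?P = "\<lambda>x i A. i \<in> I \<longrightarrow>
    infinite A \<and> (\<forall>j\<in>I. less j i \<longrightarrow> finite (A - x j)) \<and> sparse_for (f i) A"
  have "\<exists>x. \<forall>i. ?P x i (x i)"
  proof (rule dependent_wf_choice[OF wf])
    show "?P x i A = ?P y i A" if "\<And>j. (j, i) \<in> {(i, j). less i j} \<Longrightarrow> x j = y j" for x y i A
      using that by simp
    fix i x assume "\<And>j. (j, i) \<in> {(i, j). less i j} \<Longrightarrow> ?P x j (x j)"
    then have IH: "?P x j (x j)" if "less j i" for j using that by simp
    show "\<exists>A. ?P x i A"
    proof (cases "i \<in> I")
      case True
      have "\<exists>A. infinite A \<and> (\<forall>C\<in>x ` {j \<in> I. less j i}. finite (A - C)) \<and> sparse_for (f i) A"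
      proof (rule sparse_pseudo_intersection)
        show "countable (x ` {j \<in> I. less j i})" using below[OF True] by simp
        show "infinite A" if "A \<in> x ` {j \<in> I. less j i}" for A using that IH by auto
        fix A B assume "A \<in> x ` {j \<in> I. less j i}" "B \<in> x ` {j \<in> I. less j i}"
        then obtain j k where jk: "A = x j" "B = x k" "j \<in> I" "k \<in> I" "less j i" "less k i"
          by blast
        then show "finite (A - B) \<or> finite (B - A)"
          using total[OF jk(3,4)] IH[OF jk(5)] IH[OF jk(6)] by auto
      qed
      then show ?thesis by auto
    qed simp
  qed
  then obtain x where x: "\<And>i. ?P x i (x i)" by blast
  have unb: "\<exists>i\<in>I. infinite (misses a (x i))" if a: "strict_mono a" for a
  proof -
    obtain g where "g \<in> F" "\<not> le_star g (\<lambda>n. a (n + 3))"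
      using F(1) unfolding unbounded_family_def by blast
    moreover obtain i where "i \<in> I" "g = f i" using f \<open>g \<in> F\<close> unfolding bij_betw_def by blast
    ultimately show ?thesis using x[of i] sparse_misses[OF _ a] by blast
  qed
  have "unbounded_tower I less x"
  proof
    show "wf {(i, j). less i j}" by (rule wf)
    show "less i k" if "less i j" "less j k" for i j k using that by (rule trans)
    show "less i j \<or> i = j \<or> less j i" if "i \<in> I" "j \<in> I" for i j using that by (rule total)
    show "countable {i \<in> I. less i j}" if "j \<in> I" for j using that by (rule below)
    show "\<exists>j\<in>I. \<forall>i\<in>C. less i j" if "countable C" "C \<subseteq> I" for C using that by (rule bounded)
    show "infinite (x i)" if "i \<in> I" for i using x[of i] that by simp
    show "finite (x j - x i)" if "i \<in> I" "j \<in> I" "less i j" for i j using x[of j] that by simp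
    show "\<exists>i\<in>I. infinite (misses a (x i))" if "strict_mono a" for a using that by (rule unb)
  qed
  then show ?thesis by blast
qed

section \<open>Missed intervals and almost inclusion\<close>

text \<open>Beyond a bound \<open>m\<close> of the finite set \<open>B - A\<close>, an interval
  avoiding \<open>A\<close> avoids \<open>B\<close>. This \<open>m\<close> is uniform in
  \<open>a\<close>, so it serves for infinitely many partitions at once.\<close>

lemma misses_almost_subset:
  assumes "finite (B - A)"
  shows "\<exists>m. \<forall>a k. k \<in> misses a A \<longrightarrow> m \<le> a k \<longrightarrow> k \<in> misses a B"
proof -
  obtain m where m: "\<And>n. n \<in> B - A \<Longrightarrow> n < m"
    using assms unfolding finite_nat_set_iff_bounded by blast
  have "k \<in> misses a B" if k: "k \<in> misses a A" "m \<le> a k" for a k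
  proof -
    have "n \<notin> {a k..<a (Suc k)}" if "n \<in> B" for n
    proof (cases "n \<in> A")
      case True
      then show ?thesis using k(1) unfolding misses_def by blast
    next
      case False
      then show ?thesis using m[of n] that k(2) by simp
    qed
    then show ?thesis unfolding misses_def by blast
  qed
  then show ?thesis by blast
qed

lemma infinite_misses_almost_subset:
  assumes a: "strict_mono a" and "finite (B - A)" "infinite (misses a A)"
  shows "infinite (misses a B)"
proof -
  obtain m where m: "\<And>k. k \<in> misses a A \<Longrightarrow> m \<le> a k \<Longrightarrow> k \<in> misses a B"
    using misses_almost_subset[OF assms(2)] by blast
  have "k \<in> misses a B" if "k \<in> misses a A - {..<m}" for k
    using m[of k] that strict_mono_imp_increasing[OF a, of k] by simp
  then have "misses a A - {..<m} \<subseteq> misses a B" by blast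
  then show ?thesis using assms(3) by (meson finite_Diff2 finite_lessThan finite_subset)
qed

section \<open>The covering property of the tower space\<close>

definition fin_sets :: "nat set set" where
  "fin_sets = {A. finite A}"

text \<open>The Galvin--Miller argument: the sets missing an interval \<open>{a k..<a (Suc k)}\<close> agree up to
  \<open>a (Suc k)\<close> with a subset of \<open>{..<a k}\<close>, and there are only finitely many of those.\<close>

lemma intervals_exist:
  assumes X: "fin_sets \<subseteq> X"
    and op: "\<And>U. U \<in> \<U> \<Longrightarrow> openin (subtopology michael_topology X) U"
    and W: "\<And>k F. finite F \<Longrightarrow> F \<subseteq> X \<Longrightarrow> \<exists>U\<in>W k. F \<subseteq> U" "\<And>k. W k \<subseteq> \<U>"
  shows "\<exists>a U. strict_mono a \<and> (\<forall>k. U k \<in> W k \<and> (\<forall>A\<in>X. k \<in> misses a A \<longrightarrow> A \<in> U k))"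
proof -
  \<comment> \<open>One \<open>U\<close> is chosen to contain all subsets of \<open>{..<m}\<close>.
    Then \<open>n\<close> is taken beyond the finitely many cylinder lengths at these subsets, so a
    set avoiding \<open>{m..<n}\<close> lies in the cylinder of its trace below
    \<open>m\<close>.\<close>
  have step: "\<exists>n>m. \<exists>U\<in>W k. \<forall>A\<in>X. A \<inter> {m..<n} = {} \<longrightarrow> A \<in> U" for m k
  proof -
    have "finite (Pow {..<m})" "Pow {..<m} \<subseteq> X"
      using X unfolding fin_sets_def by (auto intro: finite_subset)
    then obtain U where U: "U \<in> W k" "Pow {..<m} \<subseteq> U" using W(1) by blast
    then have "openin (subtopology michael_topology X) U" using op W(2) by blast
    then obtain V where V: "openin michael_topology V" "U = V \<inter> X"
      unfolding openin_subtopology by blast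
    have "\<forall>s\<in>Pow {..<m}. \<exists>n. \<forall>B. B \<inter> {..<n} = s \<inter> {..<n} \<longrightarrow> B \<in> V"
    proof
      fix s assume s: "s \<in> Pow {..<m}"
      then have "finite s" by (auto intro: finite_subset)
      moreover have "s \<in> V" using s U(2) V(2) by blast
      ultimately show "\<exists>n. \<forall>B. B \<inter> {..<n} = s \<inter> {..<n} \<longrightarrow> B \<in> V"
        using V(1) unfolding openin_michael_topology by blast
    qed
    from bchoice[OF this] obtain \<nu> where
      \<nu>: "\<forall>s\<in>Pow {..<m}. \<forall>B. B \<inter> {..<\<nu> s} = s \<inter> {..<\<nu> s} \<longrightarrow> B \<in> V" ..
    define n where "n = Suc (Max (insert m (\<nu> ` Pow {..<m})))"
    have n: "m < n" "\<And>s. s \<in> Pow {..<m} \<Longrightarrow> \<nu> s \<le> n"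
      unfolding n_def by (auto simp: less_Suc_eq_le intro!: le_SucI Max_ge)
    have "A \<in> U" if A: "A \<in> X" "A \<inter> {m..<n} = {}" for A
    proof -
      let ?s = "A \<inter> {..<m}"
      have "A \<inter> {..<n} = ?s \<inter> {..<n}" using A(2) by (auto simp: disjoint_iff not_le[symmetric])
      then have "A \<inter> {..<\<nu> ?s} = ?s \<inter> {..<\<nu> ?s}" by (rule agree_below_mono) (rule n(2), blast)
      then have "A \<in> V" using bspec[OF \<nu>, of ?s] by simp
      then show ?thesis using V(2) A(1) by simp
    qed
    then show ?thesis using n(1) U(1) by blast
  qed
  have "\<exists>a. \<forall>k. True \<and> (a k < a (Suc k) \<and> (\<exists>U\<in>W k. \<forall>A\<in>X. A \<inter> {a k..<a (Suc k)} = {} \<longrightarrow> A \<in> U))"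
    by (rule dependent_nat_choice) (use step in auto)
  then obtain a where a: "\<forall>k. a k < a (Suc k) \<and> (\<exists>U\<in>W k. \<forall>A\<in>X. A \<inter> {a k..<a (Suc k)} = {} \<longrightarrow> A \<in> U)"
    by auto
  then have "\<forall>k. \<exists>U. U \<in> W k \<and> (\<forall>A\<in>X. A \<inter> {a k..<a (Suc k)} = {} \<longrightarrow> A \<in> U)"
    by (simp add: Bex_def)
  from choice[OF this] obtain U where
    "\<forall>k. U k \<in> W k \<and> (\<forall>A\<in>X. A \<inter> {a k..<a (Suc k)} = {} \<longrightarrow> A \<in> U k)" ..
  moreover have "strict_mono a" using a by (simp add: strict_monoI_Suc)
  ultimately show ?thesis unfolding misses_def by (intro exI[of _ a] exI[of _ U]) simp
qed

text \<open>At stage \<open>k\<close> the choice is confined to cover members containing the first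
  \<open>k + 1\<close> points of \<open>C\<close>. Such members still capture every finite set, and
  each point of \<open>C\<close> is captured from some stage on.\<close>

lemma intervals_exist_countable:
  assumes X: "fin_sets \<subseteq> X" and cov: "omega_cover (subtopology michael_topology X) \<U>"
    and C: "countable C" "C \<subseteq> X"
  shows "\<exists>a U. strict_mono a \<and> (\<forall>k. U k \<in> \<U>) \<and> (\<forall>k. \<forall>A\<in>X. k \<in> misses a A \<longrightarrow> A \<in> U k) \<and>
    (\<forall>A\<in>C. \<exists>m. \<forall>k\<ge>m. A \<in> U k)"
proof -
  \<comment> \<open>Intersecting with \<open>C\<close> discards the arbitrary value of
    \<open>from_nat_into\<close> at empty \<open>C\<close>.\<close>
  define W where "W k = {U \<in> \<U>. C \<inter> from_nat_into C ` {..k} \<subseteq> U}" for k :: nat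
  have big: "\<exists>U\<in>W k. F \<subseteq> U" if "finite F" "F \<subseteq> X" for k F
  proof -
    let ?F = "F \<union> (C \<inter> from_nat_into C ` {..k})"
    have "finite ?F" "?F \<subseteq> X" using that C(2) by auto
    moreover have "topspace (subtopology michael_topology X) = X" by simp
    ultimately obtain U where "U \<in> \<U>" "?F \<subseteq> U" using cov unfolding omega_cover_def by metis
    then show ?thesis unfolding W_def by blast
  qed
  have "\<exists>a U. strict_mono a \<and> (\<forall>k. U k \<in> W k \<and> (\<forall>A\<in>X. k \<in> misses a A \<longrightarrow> A \<in> U k))"
    by (rule intervals_exist[where \<U> = \<U>])
      (use X cov big in \<open>auto simp: omega_cover_def W_def\<close>)
  then obtain a U where aU: "strict_mono a" "\<And>k. U k \<in> W k"
    "\<And>k A. A \<in> X \<Longrightarrow> k \<in> misses a A \<Longrightarrow> A \<in> U k" by blast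
  have "A \<in> U k" if "A \<in> C" "to_nat_on C A \<le> k" for A k
  proof -
    have "from_nat_into C (to_nat_on C A) = A" using that(1) C(1) by simp
    then have "A \<in> C \<inter> from_nat_into C ` {..k}" using that by (metis IntI atMost_iff imageI)
    then show ?thesis using aU(2)[of k] unfolding W_def by blast
  qed
  then show ?thesis using aU unfolding W_def by blast
qed

context unbounded_tower
begin

definition tower_space :: "nat set set" where
  "tower_space = fin_sets \<union> x ` I"

lemma gamma_space_tower_space: "gamma_space (subtopology michael_topology tower_space)"
  unfolding gamma_space_def
proof (intro allI impI)
  let ?T = "subtopology michael_topology tower_space"
  fix \<U> assume cov: "omega_cover ?T \<U>"
  have X: "fin_sets \<subseteq> tower_space" unfolding tower_space_def by simp
  have cov_open: "openin ?T U" if "U \<in> \<U>" for U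
    using cov that unfolding omega_cover_def by (elim conjE) (rule bspec)
  have cov_top: "topspace ?T \<notin> \<U>"
    using cov unfolding omega_cover_def by (elim conjE)
  define C where "C i = x ` {j \<in> I. j \<sqsubset> i}" for i
  have C: "countable (C i)" "C i \<subseteq> tower_space" if "i \<in> I" for i
    using countable_below[OF that] unfolding C_def tower_space_def by auto
  have "\<forall>i\<in>I. \<exists>p. strict_mono (fst p) \<and> (\<forall>k. snd p k \<in> \<U>) \<and>
      (\<forall>k. \<forall>A\<in>tower_space. k \<in> misses (fst p) A \<longrightarrow> A \<in> snd p k) \<and>
      (\<forall>A\<in>C i. \<exists>m. \<forall>k\<ge>m. A \<in> snd p k)"
    using intervals_exist_countable[OF X cov C] by simp
  from bchoice[OF this] obtain p where p: "\<forall>i\<in>I. strict_mono (fst (p i)) \<and> (\<forall>k. snd (p i) k \<in> \<U>) \<and>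
      (\<forall>k. \<forall>A\<in>tower_space. k \<in> misses (fst (p i)) A \<longrightarrow> A \<in> snd (p i) k) \<and>
      (\<forall>A\<in>C i. \<exists>m. \<forall>k\<ge>m. A \<in> snd (p i) k)" ..
  define a where "a i = fst (p i)" for i
  define U where "U i = snd (p i)" for i
  have a: "strict_mono (a i)" and U: "U i k \<in> \<U>"
    and missU: "A \<in> tower_space \<Longrightarrow> k \<in> misses (a i) A \<Longrightarrow> A \<in> U i k"
    and CU: "A \<in> C i \<Longrightarrow> \<exists>m. \<forall>k\<ge>m. A \<in> U i k" if "i \<in> I" for i k A
    using p that unfolding a_def U_def by blast+
  \<comment> \<open>An index whose set misses infinitely many intervals can be raised above the
    current one, since the sets decrease modulo finite.\<close>
  have "\<exists>\<alpha>. \<forall>n. \<alpha> n \<in> I \<and> (\<alpha> n \<sqsubset> \<alpha> (Suc n) \<and> infinite (misses (a (\<alpha> n)) (x (\<alpha> (Suc n)))))"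
  proof (rule dependent_nat_choice)
    show "\<exists>i. i \<in> I" using countable_bounded[of "{}"] by auto
    fix i n assume i: "i \<in> I"
    obtain j where j: "j \<in> I" "infinite (misses (a i) (x j))" using unbounded a[OF i] by blast
    obtain k where k: "k \<in> I" "i \<sqsubset> k" "j \<sqsubset> k" using countable_bounded[of "{i, j}"] i j by auto
    then have "infinite (misses (a i) (x k))"
      using infinite_misses_almost_subset[OF a[OF i] almost_decreasing] j by blast
    then show "\<exists>k. k \<in> I \<and> (i \<sqsubset> k \<and> infinite (misses (a i) (x k)))" using k by blast
  qed
  then obtain \<alpha> where \<alpha>: "\<And>n. \<alpha> n \<in> I" "\<And>n. \<alpha> n \<sqsubset> \<alpha> (Suc n)"
    "\<And>n. infinite (misses (a (\<alpha> n)) (x (\<alpha> (Suc n))))" by blast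
  have \<alpha>_less: "\<alpha> m \<sqsubset> \<alpha> n" if "m < n" for m n
    using that by (induction rule: less_Suc_induct) (use \<alpha>(2) trans in blast)+
  define B where "B = {j \<in> I. \<forall>n. \<alpha> n \<sqsubset> j}"
  have "\<exists>j. j \<in> B" using countable_bounded[of "range \<alpha>"] \<alpha>(1) unfolding B_def by auto
  \<comment> \<open>Since \<open>l\<close> is the least strict upper bound of the
    \<open>\<alpha> n\<close>, every index below \<open>l\<close> is eventually below
    \<open>\<alpha> n\<close>.\<close>
  then obtain l where l: "l \<in> B" "\<And>j. j \<sqsubset> l \<Longrightarrow> j \<notin> B" using wfE_min[OF wf] by (metis case_prodI mem_Collect_eq)
  then have lI: "l \<in> I" and \<alpha>l: "\<alpha> n \<sqsubset> l" for n unfolding B_def by auto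
  have J: "infinite (misses (a (\<alpha> n)) (x l))" for n
    using infinite_misses_almost_subset[OF a almost_decreasing \<alpha>(3)] \<alpha> \<alpha>l lI by blast
  define d where "d = from_nat_into (C l)"
  \<comment> \<open>Three demands on the diagonal choice: the interval is missed by
    \<open>x l\<close>; the intervals move to infinity, so sets almost contained in
    \<open>x l\<close> miss almost all of them; and those of the first \<open>n + 1\<close> points
    of \<open>C l\<close> that already lie in \<open>C (\<alpha> n)\<close> are captured.\<close>
  have "\<exists>k. k \<in> misses (a (\<alpha> n)) (x l) \<and> n \<le> k \<and>
      (\<forall>m\<le>n. d m \<in> C (\<alpha> n) \<longrightarrow> d m \<in> U (\<alpha> n) k)" for n
  proof -
    have "\<forall>m. \<exists>b. \<forall>k\<ge>b. d m \<in> C (\<alpha> n) \<longrightarrow> d m \<in> U (\<alpha> n) k" using CU \<alpha>(1) by blast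
    from choice[OF this] obtain b where
      b: "\<And>m k. b m \<le> k \<Longrightarrow> d m \<in> C (\<alpha> n) \<Longrightarrow> d m \<in> U (\<alpha> n) k" by blast
    obtain k where k: "k \<in> misses (a (\<alpha> n)) (x l)" "Max (insert n (b ` {..n})) < k"
      using J[of n] by (meson infinite_nat_iff_unbounded)
    then have "n \<le> k" "\<And>m. m \<le> n \<Longrightarrow> b m \<le> k" by (auto simp: less_imp_le)
    then show ?thesis using k(1) b by blast
  qed
  then obtain \<kappa> where \<kappa>: "\<And>n. \<kappa> n \<in> misses (a (\<alpha> n)) (x l)" "\<And>n. n \<le> \<kappa> n"
    "\<And>m n. m \<le> n \<Longrightarrow> d m \<in> C (\<alpha> n) \<Longrightarrow> d m \<in> U (\<alpha> n) (\<kappa> n)" by metis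
  define V where "V n = U (\<alpha> n) (\<kappa> n)" for n
  have V: "\<exists>N. \<forall>n\<ge>N. A \<in> V n" if A: "A \<in> tower_space" for A
  proof (cases "finite (A - x l)")
    case True
    then obtain m where m: "\<And>a k. k \<in> misses a (x l) \<Longrightarrow> m \<le> a k \<Longrightarrow> k \<in> misses a A"
      using misses_almost_subset by blast
    have "A \<in> V n" if "m \<le> n" for n
    proof -
      have "\<kappa> n \<le> a (\<alpha> n) (\<kappa> n)" by (rule strict_mono_imp_increasing[OF a[OF \<alpha>(1)]])
      then have "m \<le> a (\<alpha> n) (\<kappa> n)" using that \<kappa>(2)[of n] by simp
      then show ?thesis unfolding V_def using m \<kappa>(1) missU[OF \<alpha>(1) A] by blast
    qed
    then show ?thesis by blast
  next
    case False
    then have "infinite A" by blast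
    then obtain i where i: "i \<in> I" "A = x i" using A unfolding tower_space_def fin_sets_def by blast
    have "i \<sqsubset> l"
      using total[OF i(1) lI] almost_decreasing[OF lI i(1)] False i(2) by auto
    then have Al: "A \<in> C l" using i unfolding C_def by blast
    \<comment> \<open>By minimality of \<open>l\<close>, the index \<open>i\<close> is at most
      \<open>\<alpha> N\<close>, hence below every later \<open>\<alpha> n\<close>.\<close>
    obtain N where N: "\<not> \<alpha> N \<sqsubset> i" using l(2)[OF \<open>i \<sqsubset> l\<close>] i(1) unfolding B_def by blast
    have "A \<in> V n" if "N < n" "to_nat_on (C l) A \<le> n" for n
    proof -
      have "i \<sqsubset> \<alpha> n" using total[OF i(1) \<alpha>(1)[of N]] N \<alpha>_less[OF that(1)] trans by blast
      then have "A \<in> C (\<alpha> n)" using i unfolding C_def by blast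
      moreover have "A = d (to_nat_on (C l) A)" unfolding d_def using Al C(1)[OF lI] by simp
      ultimately show ?thesis unfolding V_def using \<kappa>(3)[OF that(2)] by metis
    qed
    then show ?thesis by (meson Suc_le_lessD max.bounded_iff)
  qed
  have VU: "V n \<in> \<U>" for n unfolding V_def using U \<alpha>(1) by blast
  have "point_cofinite_cover ?T (range V)"
    unfolding point_cofinite_cover_def
  proof (intro conjI ballI)
    show op: "openin ?T W" if "W \<in> range V" for W
      using that VU cov_open by blast
    show "\<Union>(range V) = topspace ?T"
    proof
      show "\<Union>(range V) \<subseteq> topspace ?T" using op openin_subset by blast
      show "topspace ?T \<subseteq> \<Union>(range V)" using V by fastforce
    qed
    show "infinite (range V)"
    proof
      \<comment> \<open>A member repeated infinitely often would contain every point, but an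
        \<omega>-cover does not contain the whole space.\<close>
      assume "finite (range V)"
      then obtain n where n: "infinite {m. V m = V n}"
        using pigeonhole_infinite[of UNIV V] by auto
      have "A \<in> V n" if A: "A \<in> tower_space" for A
      proof -
        obtain N where N: "\<And>m. N \<le> m \<Longrightarrow> A \<in> V m" using V[OF A] by blast
        obtain m where "m \<in> {m. V m = V n}" "N < m" using n by (meson infinite_nat_iff_unbounded)
        then show ?thesis using N[of m] by simp
      qed
      moreover have "V n \<subseteq> topspace ?T" using op openin_subset by blast
      ultimately have "V n = topspace ?T" by auto
      then show False using VU[of n] cov_top by simp
    qed
    fix A assume "A \<in> topspace ?T"
    then obtain N where N: "\<And>n. N \<le> n \<Longrightarrow> A \<in> V n" using V by auto
    have "{W \<in> range V. A \<notin> W} \<subseteq> V ` {..<N}" using N not_le by blast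
    then show "finite {W \<in> range V. A \<notin> W}" using finite_subset by blast
  qed
  then show "\<exists>\<V>\<subseteq>\<U>. point_cofinite_cover ?T \<V>" using VU by blast
qed

text \<open>Uncountability of \<open>I\<close> does not settle this, since \<open>x\<close> is not
  assumed injective. Given an enumeration of the sets, a partition whose \<open>n\<close>-th
  interval meets the first \<open>n + 1\<close> of them would refute unboundedness.\<close>

lemma uncountable_range_x: "uncountable (x ` I)"
proof
  assume cnt: "countable (x ` I)"
  define z where "z = from_nat_into (x ` I)"
  have "I \<noteq> {}" using countable_bounded[of "{}"] by auto
  then have ran: "range z = x ` I" unfolding z_def using cnt by (intro range_from_nat_into) auto
  have inf: "infinite (z m)" for m using ran infinite_x by (metis imageE rangeI)
  have "\<exists>a. \<forall>n. True \<and> (a n < a (Suc n) \<and> (\<forall>m\<le>n. z m \<inter> {a n..<a (Suc n)} \<noteq> {}))"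
  proof (rule dependent_nat_choice)
    fix s n
    have "\<forall>m. \<exists>y. y \<in> z m \<and> s < y" using inf by (meson infinite_nat_iff_unbounded)
    from choice[OF this] obtain y where y: "\<And>m. y m \<in> z m" "\<And>m. s < y m" by blast
    define t where "t = Suc (Max (insert s (y ` {..n})))"
    have "s < t" "\<And>m. m \<le> n \<Longrightarrow> y m < t" unfolding t_def
      by (auto simp: less_Suc_eq_le intro!: max.coboundedI2)
    then have "s < t \<and> (\<forall>m\<le>n. z m \<inter> {s..<t} \<noteq> {})"
      using y by (metis IntI atLeastLessThan_iff empty_iff less_imp_le)
    then show "\<exists>t. True \<and> (s < t \<and> (\<forall>m\<le>n. z m \<inter> {s..<t} \<noteq> {}))" by blast
  qed simp
  then obtain a where a: "\<And>n. a n < a (Suc n)" "\<And>m n. m \<le> n \<Longrightarrow> z m \<inter> {a n..<a (Suc n)} \<noteq> {}"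
    by blast
  have "strict_mono a" using a(1) by (rule strict_monoI_Suc)
  then obtain i where i: "i \<in> I" "infinite (misses a (x i))" using unbounded by blast
  then obtain m where m: "x i = z m" using ran by (metis imageE imageI)
  have "k < m" if "k \<in> misses a (x i)" for k
    using a(2)[of m k] that m unfolding misses_def by (auto simp: not_le[symmetric])
  then have "misses a (x i) \<subseteq> {..<m}" by blast
  then show False using i(2) finite_subset by blast
qed

end

section \<open>The product with the irrationals\<close>

text \<open>Starting at \<open>2!\<close> makes successive denominators grow by a factor of at least
  3, so tails are dominated by a geometric series of ratio 1/3.\<close>

definition factorial_sum :: "nat set \<Rightarrow> real" where
  "factorial_sum A = (\<Sum>n. if n \<in> A then 1 / fact (n + 2) else 0)"

lemma fact_mult_power3_le:
  assumes "2 \<le> N"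
  shows "fact N * 3 ^ i \<le> (fact (N + i) :: real)"
proof (induction i)
  case (Suc i)
  have "fact N * 3 ^ Suc i = 3 * (fact N * 3 ^ i :: real)" by simp
  also have "\<dots> \<le> real (N + i + 1) * fact (N + i)"
    using assms Suc by (intro mult_mono) auto
  also have "\<dots> = fact (N + Suc i)" by simp
  finally show ?case .
qed simp

lemma inverse_fact_le: "1 / fact (n + 2) \<le> (1 / 3 :: real) ^ n"
proof -
  have "(3::real) ^ n \<le> fact 2 * 3 ^ n" by simp
  also have "\<dots> \<le> fact (2 + n)" by (rule fact_mult_power3_le) simp
  finally show ?thesis by (simp add: power_one_over frac_le add.commute)
qed

lemma summable_factorial_sum:
  "summable (\<lambda>n. if n \<in> A then 1 / fact (n + 2) else 0 :: real)"
proof (rule summable_comparison_test)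
  show "summable (\<lambda>n. (1 / 3 :: real) ^ n)" by (rule summable_geometric) simp
  show "\<exists>N. \<forall>n\<ge>N. norm (if n \<in> A then 1 / fact (n + 2) else 0 :: real) \<le> (1 / 3) ^ n"
    using inverse_fact_le by auto
qed

lemma factorial_sum_rational: "finite A \<Longrightarrow> factorial_sum A \<in> \<rat>"
  unfolding factorial_sum_def by (subst suminf_finite[of A]) (auto simp del: fact_Suc intro!: Rats_sum Rats_divide subsetD[OF Ints_subset_Rats fact_in_Ints])

text \<open>As in the classical proof for e: multiplying by \<open>fact (N + 1)\<close>, with
  \<open>N\<close> a denominator, turns the value and its first \<open>N\<close> terms into
  integers. The remaining tail \<open>R\<close> would be an integer, yet it lies strictly between 0
  and 1.\<close>

lemma factorial_sum_irrational:
  assumes "infinite A"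
  shows "factorial_sum A \<notin> \<rat>"
proof
  assume "factorial_sum A \<in> \<rat>"
  then obtain p q where q: "0 < q" and pq: "factorial_sum A = of_int p / of_int q"
    by (metis Rats_cases')
  define N where "N = nat q"
  have N: "0 < N" "factorial_sum A * real N \<in> \<int>" using q pq unfolding N_def by auto
  define t where "t n = (if n \<in> A then 1 / fact (n + 2) else 0 :: real)" for n
  have sm: "summable t" using summable_factorial_sum unfolding t_def .
  have sm': "summable (\<lambda>i. t (i + N))" using sm by (simp add: summable_iff_shift)
  define R where "R = fact (N + 1) * (\<Sum>i. t (i + N))"
  have nn: "0 \<le> t i" for i unfolding t_def by simp
  have "factorial_sum A = (\<Sum>i. t (i + N)) + (\<Sum>i<N. t i)"
    using suminf_split_initial_segment[OF sm] unfolding factorial_sum_def t_def .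
  then have "R = fact (N + 1) * factorial_sum A - (\<Sum>i<N. fact (N + 1) * t i)"
    unfolding R_def by (simp add: sum_distrib_left distrib_left del: fact_Suc)
  moreover have "fact (N + 1) * factorial_sum A \<in> \<int>"
  proof -
    obtain c where "fact (N + 1) = N * c" using dvd_fact[of N "N + 1"] N(1) by (auto elim: dvdE)
    then have "(fact (N + 1) :: real) = real N * real c" by (metis of_nat_fact of_nat_mult)
    then have "fact (N + 1) * factorial_sum A = real c * (factorial_sum A * real N)"
      by (simp only: mult_ac)
    then show ?thesis using N(2) by (metis Ints_mult Ints_of_nat)
  qed
  moreover have "(\<Sum>i<N. fact (N + 1) * t i) \<in> \<int>"
  proof (rule Ints_sum)
    fix i assume "i \<in> {..<N}"
    then have "(fact (i + 2) :: nat) dvd fact (N + 1)" by (intro fact_dvd) simp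
    then obtain c where "fact (N + 1) = fact (i + 2) * (c :: nat)" by (elim dvdE)
    then have "(fact (N + 1) :: real) = fact (i + 2) * real c" by (metis of_nat_fact of_nat_mult)
    then have "fact (N + 1) * (1 / fact (i + 2)) = real c" by (simp del: fact_Suc)
    then show "fact (N + 1) * t i \<in> \<int>" unfolding t_def by auto
  qed
  ultimately have "R \<in> \<int>" by simp
  moreover have "0 < R"
  proof -
    obtain n where n: "n \<in> A" "N < n" using assms by (meson infinite_nat_iff_unbounded)
    have "0 < t ((n - N) + N)" using n unfolding t_def by simp
    then have "0 < (\<Sum>i. t (i + N))" by (rule suminf_pos2[OF sm' nn])
    then show ?thesis unfolding R_def by simp
  qed
  moreover have "R < 1"
  proof -
    \<comment> \<open>This geometric majorant sums to 1/2.\<close>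
    have le: "fact (N + 1) * t (i + N) \<le> (1 / 3) * (1 / 3) ^ i" for i
    proof -
      have "fact (N + 1) * 3 ^ Suc i \<le> (fact (N + 1 + Suc i) :: real)"
        by (rule fact_mult_power3_le) (use N in simp)
      then have "fact (N + 1) * (1 / fact (i + N + 2)) \<le> (1 / 3 :: real) ^ Suc i"
        by (simp add: field_simps power_one_over del: fact_Suc)
      then show ?thesis unfolding t_def by auto
    qed
    have geo: "summable (\<lambda>i. (1 / 3 :: real) * (1 / 3) ^ i)"
      by (intro summable_mult summable_geometric) simp
    have "R = (\<Sum>i. fact (N + 1) * t (i + N))"
      unfolding R_def by (rule suminf_mult[OF sm', symmetric])
    also have "\<dots> \<le> (\<Sum>i. (1 / 3) * (1 / 3) ^ i)"
      by (rule suminf_le[OF le summable_mult[OF sm'] geo])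
    also have "\<dots> = (1 / 3) * (1 / (1 - 1 / 3))"
      by (subst suminf_mult) (simp_all add: suminf_geometric)
    finally show ?thesis by simp
  qed
  ultimately show False by (elim Ints_cases) simp
qed

text \<open>For sets agreeing below \<open>n\<close>, the values differ by at most the tail from
  \<open>n\<close> of the full series, which tends to 0.\<close>

lemma continuous_map_factorial_sum: "continuous_map michael_topology euclideanreal factorial_sum"
  unfolding continuous_map_def
proof (intro conjI allI impI)
  fix S :: "real set" assume "openin euclideanreal S"
  then have S: "open S" by simp
  have "\<exists>n. \<forall>B. B \<inter> {..<n} = A \<inter> {..<n} \<longrightarrow> factorial_sum B \<in> S" if A: "factorial_sum A \<in> S" for A
  proof -
    obtain e where e: "0 < e" "\<And>y. dist y (factorial_sum A) < e \<Longrightarrow> y \<in> S"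
      using S A unfolding open_dist by blast
    have sm: "summable (\<lambda>n. 1 / fact (n + 2) :: real)" using summable_factorial_sum[of UNIV] by simp
    obtain n where n: "norm (\<Sum>i. 1 / fact (i + n + 2) :: real) < e"
      using suminf_exist_split[OF e(1) sm] by blast
    have "factorial_sum B \<in> S" if B: "B \<inter> {..<n} = A \<inter> {..<n}" for B
    proof -
      define t where "t C i = (if i \<in> C then 1 / fact (i + 2) else 0 :: real)" for C i
      have smt: "summable (t C)" "summable (\<lambda>i. t C (i + n))" for C
        using summable_factorial_sum[of C] unfolding t_def[symmetric] by (auto simp: summable_iff_shift)
      have eq: "factorial_sum C = (\<Sum>i. t C (i + n)) + (\<Sum>i<n. t C i)" for C
        using suminf_split_initial_segment[OF smt(1)] unfolding factorial_sum_def t_def .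
      have "(\<Sum>i<n. t B i) = (\<Sum>i<n. t A i)"
        using B unfolding t_def by (intro sum.cong) auto
      then have "factorial_sum B - factorial_sum A = (\<Sum>i. t B (i + n) - t A (i + n))"
        using eq[of A] eq[of B] suminf_diff[OF smt(2) smt(2), of B A] by simp
      moreover have "norm (\<Sum>i. t B (i + n) - t A (i + n)) \<le> (\<Sum>i. 1 / fact (i + n + 2))"
      proof (rule norm_suminf_le)
        show "norm (t B (i + n) - t A (i + n)) \<le> 1 / fact (i + n + 2)" for i
          unfolding t_def by auto
        show "summable (\<lambda>i. 1 / fact (i + n + 2) :: real)"
          using sm by (subst summable_iff_shift[of "\<lambda>i. 1 / fact (i + 2)"])
      qed
      ultimately show ?thesis using n by (intro e(2)) (simp add: dist_real_def)
    qed
    then show ?thesis by blast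
  qed
  then show "openin michael_topology {A \<in> topspace michael_topology. factorial_sum A \<in> S}"
    unfolding openin_michael_topology by simp
qed simp

lemma not_Lindelof_prod_irrationals:
  assumes "uncountable {A \<in> X. infinite A}"
  shows "\<not> Lindelof_space (prod_topology (subtopology michael_topology X) irrationals_topology)"
proof
  let ?T = "prod_topology (subtopology michael_topology X) irrationals_topology"
  define Y where "Y = {A \<in> X. infinite A}"
  \<comment> \<open>\<open>N\<close> is the complement of the graph, and the strips
    \<open>s A\<close> cover the part over infinite sets. Over a finite set the first value is
    rational and the second coordinate irrational, so such points lie in \<open>N\<close>.\<close>
  define N where "N = {z \<in> topspace ?T. factorial_sum (fst z) - snd z \<in> - {0}}"
  define s where "s A = {A :: nat set} \<times> (- \<rat> :: real set)" for A
  assume L: "Lindelof_space ?T"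
  have top: "topspace ?T = X \<times> - \<rat>" unfolding irrationals_topology_def by simp
  have "continuous_map ?T euclideanreal (\<lambda>z. factorial_sum (fst z))"
    using continuous_map_compose[OF continuous_map_fst
      continuous_map_from_subtopology[OF continuous_map_factorial_sum]] by (simp add: o_def)
  moreover have "continuous_map ?T euclideanreal snd"
    using continuous_map_into_fulltopology continuous_map_snd unfolding irrationals_topology_def by blast
  ultimately have "continuous_map ?T euclideanreal (\<lambda>z. factorial_sum (fst z) - snd z)"
    by (rule continuous_map_diff)
  then have N: "openin ?T N" unfolding N_def by (rule openin_continuous_map_preimage) auto
  have s: "openin ?T (s A)" if "A \<in> Y" for A
  proof -
    have "openin michael_topology {A}" using that unfolding Y_def openin_michael_topology by simp
    then have "openin (subtopology michael_topology X) {A}"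
      using that unfolding Y_def openin_subtopology by blast
    moreover have "openin irrationals_topology (- \<rat>)"
      unfolding irrationals_topology_def by (metis openin_topspace topspace_euclidean_subtopology)
    ultimately show ?thesis unfolding s_def by (simp add: openin_prod_Times_iff)
  qed
  then have op: "openin ?T U" if "U \<in> insert N (s ` Y)" for U using that N by auto
  have "\<Union>(insert N (s ` Y)) = topspace ?T"
  proof
    show "\<Union>(insert N (s ` Y)) \<subseteq> topspace ?T" using N s openin_subset by blast
    show "topspace ?T \<subseteq> \<Union>(insert N (s ` Y))"
    proof
      fix z assume z: "z \<in> topspace ?T"
      show "z \<in> \<Union>(insert N (s ` Y))"
      proof (cases "finite (fst z)")
        case True
        then have "z \<in> N" using z top factorial_sum_rational unfolding N_def by force
        then show ?thesis by simp
      next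
        case False
        have "z \<in> X \<times> - \<rat>" using z unfolding top .
        then have "fst z \<in> Y" "z \<in> s (fst z)"
          using False unfolding Y_def s_def by (simp_all add: mem_Times_iff)
        then show ?thesis by (intro UnionI[of "s (fst z)"]) simp_all
      qed
    qed
  qed
  then obtain \<V> where \<V>: "countable \<V>" "\<V> \<subseteq> insert N (s ` Y)" "\<Union>\<V> = topspace ?T"
    using Lindelof_spaceD[OF L op] by metis
  \<comment> \<open>The graph point over \<open>A\<close> lies outside \<open>N\<close> and in no
    strip other than \<open>s A\<close>, so no strip can be omitted.\<close>
  have "s A \<in> \<V>" if A: "A \<in> Y" for A
  proof -
    have "(A, factorial_sum A) \<in> topspace ?T"
      using A factorial_sum_irrational unfolding top Y_def by simp
    then obtain W where W: "W \<in> \<V>" "(A, factorial_sum A) \<in> W" using \<V>(3) by blast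
    then obtain B where "W = s B" using \<V>(2) unfolding N_def by auto
    then show ?thesis using W unfolding s_def by auto
  qed
  then have "countable (s ` Y)" using \<V>(1) countable_subset by (metis image_subsetI)
  moreover have "inj_on s Y"
  proof -
    \<comment> \<open>An irrational number is exhibited to make the second factor nonempty, so that
      a strip determines its \<open>A\<close>.\<close>
    have "factorial_sum UNIV \<notin> \<rat>" by (rule factorial_sum_irrational) simp
    then show ?thesis unfolding s_def inj_on_def by (auto simp: times_eq_iff)
  qed
  ultimately show False using assms countable_image_inj_on unfolding Y_def by blast
qed

theorem theorem4p6:
  assumes "b_eq_aleph1"
  shows "\<exists>X :: nat set set.
           gamma_space (subtopology michael_topology X) \<and>
           Lindelof_space (subtopology michael_topology X) \<and>
           \<not> Lindelof_space (prod_topology (subtopology michael_topology X) irrationals_topology)"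
proof -
  obtain I :: "nat set set" and less x where "unbounded_tower I less x"
    using unbounded_tower_exists[OF assms] by blast
  then interpret unbounded_tower I less x .
  have "x ` I \<subseteq> {A \<in> tower_space. infinite A}"
    using infinite_x unfolding tower_space_def by auto
  then have "uncountable {A \<in> tower_space. infinite A}"
    using uncountable_range_x countable_subset by blast
  then show ?thesis
    using gamma_space_tower_space gamma_space_imp_Lindelof_space not_Lindelof_prod_irrationals by blast
qed

end
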